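(* Consider the one-stage, two-player bi-matrix Bayesian game $(J_1,J_2)$ at a given state $x$, with finite nonempty type sets $\Theta_1,\Theta_2$, finite nonempty action sets $A_1,A_2$, and given beliefs $b_1(\cdot\mid x,\theta_1)$ on $\Theta_2$ (for each $\theta_1\in\Theta_1$) and $b_2(\cdot\mid x,\theta_2)$ on $\Theta_1$ (for each $\theta_2\in\Theta_2$). Let $\alpha_1(\theta_1)$, $\theta_1\in\Theta_1$, and $\alpha_2(\theta_2)$, $\theta_2\in\Theta_2$, be any strictly positive finite numbers. Consider the following optimization problem $C$ in the decision variables $\sigma_1=(\sigma_1(a_1\mid x,\theta_1))_{a_1\in A_1,\theta_1\in\Theta_1}$, $\sigma_2=(\sigma_2(a_2\mid x,\theta_2))_{a_2\in A_2,\theta_2\in\Theta_2}$, $s_1=(s_1(x,\theta_1))_{\theta_1\in\Theta_1}\in\mathbb{R}^{\Theta_1}$, $s_2=(s_2(x,\theta_2))_{\theta_2\in\Theta_2}\in\mathbb{R}^{\Theta_2}$: $$\begin{aligned} \max_{\sigma_1,\sigma_2,s_1,s_2}\ & \sum_{\theta_1\in\Theta_1}\alpha_1(\theta_1)s_1(x,\theta_1)+\sum_{\theta_2\in\Theta_2}\alpha_2(\theta_2)s_2(x,\theta_2)\\ &+\sum_{\theta_1\in\Theta_1}\alpha_1(\theta_1)\,\mathbb{E}_{\theta_2\sim b_1,\,a_1\sim\sigma_1,\,a_2\sim\sigma_2}[J_1(x,a_1,a_2,\theta_1,\theta_2)]\\ &+\sum_{\theta_2\in\Theta_2}\alpha_2(\theta_2)\,\mathbb{E}_{\theta_1\sim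 b_2,\,a_1\sim\sigma_1,\,a_2\sim\sigma_2}[J_2(x,a_1,a_2,\theta_1,\theta_2)] \end{aligned}$$ subject to (a) $\mathbb{E}_{\theta_1\sim b_2,\,a_1\sim\sigma_1}[J_2(x,a_1,a_2,\theta_1,\theta_2)]\le -s_2(x,\theta_2)$ for all $\theta_2\in\Theta_2$ and $a_2\in A_2$; (b) $\sum_{a_1\in A_1}\sigma_1(a_1\mid x,\theta_1)=1$ and $\sigma_1(a_1\mid x,\theta_1)\ge 0$ for all $\theta_1\in\Theta_1$, $a_1\in A_1$; (c) $\mathbb{E}_{\theta_2\sim b_1,\,a_2\sim\sigma_2}[J_1(x,a_1,a_2,\theta_1,\theta_2)]\le -s_1(x,\theta_1)$ for all $\theta_1\in\Theta_1$ and $a_1\in A_1$; (d) $\sum_{a_2\in A_2}\sigma_2(a_2\mid x,\theta_2)=1$ and $\sigma_2(a_2\mid x,\theta_2)\ge 0$ for all $\theta_2\in\Theta_2$, $a_2\in A_2$. Then a strategy pair $(\sigma_1^*,\sigma_2^* )\in\Sigma_1\times\Sigma_2$ is a Static Bayesian Nash Equilibrium (SBNE) of the game at $x$ under the beliefs $(b_1,b_2)$ if and only if it is the strategy part of a solution of $C$, i.e. there exist $s_1^*,s_2^*$ such that $(\sigma_1^*,\sigma_2^*,s_1^*,s_2^* )$ is an optimal solution of $C$. Moreover, an optimal solution of $C$ exists, and at an optimal solution $(\sigma_1^*,\sigma_2^*,s_1^*,s_2^* )$ the constraints (a) and (c) are attained in the sense that $s_2^*(x,\theta_2)=-V_2(x,\theta_2)$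 for all $\theta_2\in\Theta_2$ and $s_1^*(x,\theta_1)=-V_1(x,\theta_1)$ for all $\theta_1\in\Theta_1$.
   Context: Setting. There are two players $i\in\{1,2\}$; $j$ denotes the player other than $i$. Player $i$ has a private type $\theta_i$ in a finite nonempty set $\Theta_i$ and a finite nonempty action set $A_i$. The state $x$ is fixed. The (expected) utility of player $i$ is a real-valued function $J_i(x,a_1,a_2,\theta_1,\theta_2)$ of $a_1\in A_1,a_2\in A_2,\theta_1\in\Theta_1,\theta_2\in\Theta_2$. The belief of player $i$ assigns to each own type $\theta_i\in\Theta_i$ a probability distribution $b_i(\cdot\mid x,\theta_i)$ on $\Theta_j$; the beliefs are arbitrary and given. Strategies. A (mixed) strategy of player $i$ is a map $\sigma_i$ assigning to each type $\theta_i\in\Theta_i$ a probability distribution $\sigma_i(\cdot\mid x,\theta_i)$ on $A_i$; $\Sigma_i$ is the set of all such strategies. Expectation notation. For a fixed own type $\theta_i$, $$\mathbb{E}_{\theta_j\sim b_i,\,a_1\sim\sigma_1,\,a_2\sim\sigma_2}[J_i(x,a_1,a_2,\theta_1,\theta_2)]=\sum_{\theta_j\in\Theta_j}b_i(\theta_j\mid x,\theta_i)\sum_{a_1\in A_1}\sum_{a_2\in A_2}\sigma_1(a_1\mid x,\theta_1)\,\sigma_2(a_2\mid x,\theta_2)\,J_i(x,a_1,a_2,\theta_1,\theta_2).$$ When one player's action is not listed under the expectation, it is held fixed, e.g. $\mathbb{E}_{\theta_1\sim b_2,\,a_1\sim\sigma_1}[J_2]=\sum_{\theta_1}b_2(\theta_1\mid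 x,\theta_2)\sum_{a_1}\sigma_1(a_1\mid x,\theta_1)J_2(x,a_1,a_2,\theta_1,\theta_2)$ for fixed $a_2,\theta_2$. SBNE. A pair $(\sigma_1^*,\sigma_2^* )\in\Sigma_1\times\Sigma_2$ is a Static Bayesian Nash Equilibrium under $(b_1,b_2)$ at $x$ if for all $\theta_1\in\Theta_1$, $\theta_2\in\Theta_2$: $$\mathbb{E}_{\theta_2\sim b_1,a_1\sim\sigma_1^*,a_2\sim\sigma_2^*}[J_1]\ \ge\ \mathbb{E}_{\theta_2\sim b_1,a_1\sim\sigma_1,a_2\sim\sigma_2^*}[J_1]\quad\forall\sigma_1\in\Sigma_1,$$ $$\mathbb{E}_{\theta_1\sim b_2,a_1\sim\sigma_1^*,a_2\sim\sigma_2^*}[J_2]\ \ge\ \mathbb{E}_{\theta_1\sim b_2,a_1\sim\sigma_1^*,a_2\sim\sigma_2}[J_2]\quad\forall\sigma_2\in\Sigma_2,$$ where $J_i$ abbreviates $J_i(x,a_1,a_2,\theta_1,\theta_2)$. Value function. Relative to a pair $(\sigma_1^*,\sigma_2^* )$, $V_i(x,\theta_i):=\sup_{\sigma_i\in\Sigma_i}\mathbb{E}_{\theta_j\sim b_i,\,a_i\sim\sigma_i,\,a_j\sim\sigma_j^*}[J_i(x,a_1,a_2,\theta_1,\theta_2)]$. *)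

theory Defs
  imports Complex_Main
begin

text \<open>
  Type and action sets are the universes of type variables of class \<open>finite\<close>. The definitions
  describe the stage game at one fixed state, so the state does not occur in them.
  A family of distributions \<open>p \<theta>\<close> (a belief or a mixed strategy, indexed by the player's own type)
  is a real-valued function: its entries are also the decision variables of the
  optimization problem, where the simplex constraints have to be imposed explicitly.
\<close>

definition is_distribution :: "('a::finite \<Rightarrow> real) \<Rightarrow> bool" where
  "is_distribution p \<longleftrightarrow> (\<Sum>a\<in>UNIV. p a) = 1 \<and> (\<forall>a. p a \<ge> 0)"

definition beliefs :: "('own::finite \<Rightarrow> 'other::finite \<Rightarrow> real) set" where
  "beliefs = {b. \<forall>\<theta>. is_distribution (b \<theta>)}"

definition strategies :: "('t::finite \<Rightarrow> 'a::finite \<Rightarrow> real) set" where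
  "strategies = {\<sigma>. \<forall>\<theta>. is_distribution (\<sigma> \<theta>)}"

type_synonym ('a1, 'a2, 't1, 't2) utility = "'a1 \<Rightarrow> 'a2 \<Rightarrow> 't1 \<Rightarrow> 't2 \<Rightarrow> real"

definition exp1 ::
  "('a1::finite, 'a2::finite, 't1::finite, 't2::finite) utility \<Rightarrow> ('t1 \<Rightarrow> 't2 \<Rightarrow> real) \<Rightarrow>
   ('t1 \<Rightarrow> 'a1 \<Rightarrow> real) \<Rightarrow> ('t2 \<Rightarrow> 'a2 \<Rightarrow> real) \<Rightarrow> 't1 \<Rightarrow> real" where
  "exp1 J1 b1 \<sigma>1 \<sigma>2 \<theta>1 =
     (\<Sum>\<theta>2\<in>UNIV. b1 \<theta>1 \<theta>2 *
        (\<Sum>a1\<in>UNIV. \<Sum>a2\<in>UNIV. \<sigma>1 \<theta>1 a1 * \<sigma>2 \<theta>2 a2 * J1 a1 a2 \<theta>1 \<theta>2))"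

definition exp2 ::
  "('a1::finite, 'a2::finite, 't1::finite, 't2::finite) utility \<Rightarrow> ('t2 \<Rightarrow> 't1 \<Rightarrow> real) \<Rightarrow>
   ('t1 \<Rightarrow> 'a1 \<Rightarrow> real) \<Rightarrow> ('t2 \<Rightarrow> 'a2 \<Rightarrow> real) \<Rightarrow> 't2 \<Rightarrow> real" where
  "exp2 J2 b2 \<sigma>1 \<sigma>2 \<theta>2 =
     (\<Sum>\<theta>1\<in>UNIV. b2 \<theta>2 \<theta>1 *
        (\<Sum>a1\<in>UNIV. \<Sum>a2\<in>UNIV. \<sigma>1 \<theta>1 a1 * \<sigma>2 \<theta>2 a2 * J2 a1 a2 \<theta>1 \<theta>2))"

text \<open>In \<open>act_exp1\<close> and \<open>act_exp2\<close> the player's own action is held fixed instead of being drawn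
  from a strategy.\<close>

definition act_exp1 ::
  "('a1::finite, 'a2::finite, 't1::finite, 't2::finite) utility \<Rightarrow> ('t1 \<Rightarrow> 't2 \<Rightarrow> real) \<Rightarrow>
   ('t2 \<Rightarrow> 'a2 \<Rightarrow> real) \<Rightarrow> 't1 \<Rightarrow> 'a1 \<Rightarrow> real" where
  "act_exp1 J1 b1 \<sigma>2 \<theta>1 a1 =
     (\<Sum>\<theta>2\<in>UNIV. b1 \<theta>1 \<theta>2 * (\<Sum>a2\<in>UNIV. \<sigma>2 \<theta>2 a2 * J1 a1 a2 \<theta>1 \<theta>2))"

definition act_exp2 ::
  "('a1::finite, 'a2::finite, 't1::finite, 't2::finite) utility \<Rightarrow> ('t2 \<Rightarrow> 't1 \<Rightarrow> real) \<Rightarrow>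
   ('t1 \<Rightarrow> 'a1 \<Rightarrow> real) \<Rightarrow> 't2 \<Rightarrow> 'a2 \<Rightarrow> real" where
  "act_exp2 J2 b2 \<sigma>1 \<theta>2 a2 =
     (\<Sum>\<theta>1\<in>UNIV. b2 \<theta>2 \<theta>1 * (\<Sum>a1\<in>UNIV. \<sigma>1 \<theta>1 a1 * J2 a1 a2 \<theta>1 \<theta>2))"

definition SBNE ::
  "('a1::finite, 'a2::finite, 't1::finite, 't2::finite) utility \<Rightarrow> ('a1, 'a2, 't1, 't2) utility \<Rightarrow>
   ('t1 \<Rightarrow> 't2 \<Rightarrow> real) \<Rightarrow> ('t2 \<Rightarrow> 't1 \<Rightarrow> real) \<Rightarrow>
   ('t1 \<Rightarrow> 'a1 \<Rightarrow> real) \<Rightarrow> ('t2 \<Rightarrow> 'a2 \<Rightarrow> real) \<Rightarrow> bool" where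
  "SBNE J1 J2 b1 b2 \<sigma>1 \<sigma>2 \<longleftrightarrow>
     \<sigma>1 \<in> strategies \<and> \<sigma>2 \<in> strategies \<and>
     (\<forall>\<theta>1 \<theta>2.
        (\<forall>\<tau>1\<in>strategies. exp1 J1 b1 \<sigma>1 \<sigma>2 \<theta>1 \<ge> exp1 J1 b1 \<tau>1 \<sigma>2 \<theta>1) \<and>
        (\<forall>\<tau>2\<in>strategies. exp2 J2 b2 \<sigma>1 \<sigma>2 \<theta>2 \<ge> exp2 J2 b2 \<sigma>1 \<tau>2 \<theta>2))"

text \<open>Value functions. The real suprema range over nonempty bounded sets, since strategies form a
  nonempty set and expected utilities are finite convex combinations of utilities whenever the
  beliefs and the opponent's strategy are distributions.\<close>

definition value1 ::
  "('a1::finite, 'a2::finite, 't1::finite, 't2::finite) utility \<Rightarrow> ('t1 \<Rightarrow> 't2 \<Rightarrow> real) \<Rightarrow>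
   ('t2 \<Rightarrow> 'a2 \<Rightarrow> real) \<Rightarrow> 't1 \<Rightarrow> real" where
  "value1 J1 b1 \<sigma>2 \<theta>1 = (SUP \<sigma>1\<in>strategies. exp1 J1 b1 \<sigma>1 \<sigma>2 \<theta>1)"

definition value2 ::
  "('a1::finite, 'a2::finite, 't1::finite, 't2::finite) utility \<Rightarrow> ('t2 \<Rightarrow> 't1 \<Rightarrow> real) \<Rightarrow>
   ('t1 \<Rightarrow> 'a1 \<Rightarrow> real) \<Rightarrow> 't2 \<Rightarrow> real" where
  "value2 J2 b2 \<sigma>1 \<theta>2 = (SUP \<sigma>2\<in>strategies. exp2 J2 b2 \<sigma>1 \<sigma>2 \<theta>2)"

type_synonym ('a1, 'a2, 't1, 't2) point =
  "('t1 \<Rightarrow> 'a1 \<Rightarrow> real) \<times> ('t2 \<Rightarrow> 'a2 \<Rightarrow> real) \<times> ('t1 \<Rightarrow> real) \<times> ('t2 \<Rightarrow> real)"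

fun objective ::
  "('a1::finite, 'a2::finite, 't1::finite, 't2::finite) utility \<Rightarrow> ('a1, 'a2, 't1, 't2) utility \<Rightarrow>
   ('t1 \<Rightarrow> 't2 \<Rightarrow> real) \<Rightarrow> ('t2 \<Rightarrow> 't1 \<Rightarrow> real) \<Rightarrow> ('t1 \<Rightarrow> real) \<Rightarrow> ('t2 \<Rightarrow> real) \<Rightarrow>
   ('a1, 'a2, 't1, 't2) point \<Rightarrow> real" where
  "objective J1 J2 b1 b2 \<alpha>1 \<alpha>2 (\<sigma>1, \<sigma>2, s1, s2) =
     (\<Sum>\<theta>1\<in>UNIV. \<alpha>1 \<theta>1 * s1 \<theta>1) + (\<Sum>\<theta>2\<in>UNIV. \<alpha>2 \<theta>2 * s2 \<theta>2)
     + (\<Sum>\<theta>1\<in>UNIV. \<alpha>1 \<theta>1 * exp1 J1 b1 \<sigma>1 \<sigma>2 \<theta>1)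
     + (\<Sum>\<theta>2\<in>UNIV. \<alpha>2 \<theta>2 * exp2 J2 b2 \<sigma>1 \<sigma>2 \<theta>2)"

fun feasible ::
  "('a1::finite, 'a2::finite, 't1::finite, 't2::finite) utility \<Rightarrow> ('a1, 'a2, 't1, 't2) utility \<Rightarrow>
   ('t1 \<Rightarrow> 't2 \<Rightarrow> real) \<Rightarrow> ('t2 \<Rightarrow> 't1 \<Rightarrow> real) \<Rightarrow> ('a1, 'a2, 't1, 't2) point \<Rightarrow> bool" where
  "feasible J1 J2 b1 b2 (\<sigma>1, \<sigma>2, s1, s2) \<longleftrightarrow>
     (\<forall>\<theta>2 a2. act_exp2 J2 b2 \<sigma>1 \<theta>2 a2 \<le> - s2 \<theta>2) \<and>
     (\<forall>\<theta>1. (\<Sum>a1\<in>UNIV. \<sigma>1 \<theta>1 a1) = 1 \<and> (\<forall>a1. \<sigma>1 \<theta>1 a1 \<ge> 0)) \<and>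
     (\<forall>\<theta>1 a1. act_exp1 J1 b1 \<sigma>2 \<theta>1 a1 \<le> - s1 \<theta>1) \<and>
     (\<forall>\<theta>2. (\<Sum>a2\<in>UNIV. \<sigma>2 \<theta>2 a2) = 1 \<and> (\<forall>a2. \<sigma>2 \<theta>2 a2 \<ge> 0))"

definition optimal_solution ::
  "('a1::finite, 'a2::finite, 't1::finite, 't2::finite) utility \<Rightarrow> ('a1, 'a2, 't1, 't2) utility \<Rightarrow>
   ('t1 \<Rightarrow> 't2 \<Rightarrow> real) \<Rightarrow> ('t2 \<Rightarrow> 't1 \<Rightarrow> real) \<Rightarrow> ('t1 \<Rightarrow> real) \<Rightarrow> ('t2 \<Rightarrow> real) \<Rightarrow>
   ('a1, 'a2, 't1, 't2) point \<Rightarrow> bool" where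
  "optimal_solution J1 J2 b1 b2 \<alpha>1 \<alpha>2 =
     is_arg_max (objective J1 J2 b1 b2 \<alpha>1 \<alpha>2) (feasible J1 J2 b1 b2)"

end

theory Submission
  imports Defs "HOL-Analysis.Analysis"
begin

text \<open>
  Grouping the objective as a positively weighted sum of the terms \<open>s\<^sub>i(\<theta>\<^sub>i) + E[J\<^sub>i]\<close>, constraints
  (a) and (c) make every term nonpositive, since an expectation over the own strategy is a convex
  combination of its values at pure actions. Hence the objective is at most 0 on the feasible
  set, and it is 0 exactly if no pure action improves on \<open>E[J\<^sub>i] = - s\<^sub>i(\<theta>\<^sub>i)\<close>, which is the
  equilibrium condition and identifies \<open>- s\<^sub>i\<close> with the value function. The bound 0 is attained
  because an equilibrium exists: the Nash map, which shifts weight towards actions that do better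
  than the current strategy, has a fixed point by Brouwer's theorem.
\<close>

section \<open>Expected utilities, pure actions and best responses\<close>

lemma exp1_eq_sum_act_exp1:
  "exp1 J b \<sigma>1 \<sigma>2 \<theta> = (\<Sum>a\<in>UNIV. \<sigma>1 \<theta> a * act_exp1 J b \<sigma>2 \<theta> a)"
proof -
  \<comment> \<open>The own weights depend on the own type only, so they can be pulled out of the
    sum over the opponent's types.\<close>
  have "exp1 J b \<sigma>1 \<sigma>2 \<theta> = (\<Sum>\<theta>2\<in>UNIV. \<Sum>a\<in>UNIV. \<sigma>1 \<theta> a *
      (b \<theta> \<theta>2 * (\<Sum>a2\<in>UNIV. \<sigma>2 \<theta>2 a2 * J a a2 \<theta> \<theta>2)))"
    by (simp add: exp1_def sum_distrib_left algebra_simps)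
  then show ?thesis
    by (subst (asm) sum.swap) (simp add: act_exp1_def sum_distrib_left)
qed

text \<open>Exchanging the roles of the players reduces every claim about player 2 to one about
  player 1.\<close>

definition swap_utility ::
  "('a1, 'a2, 't1, 't2) utility \<Rightarrow> ('a2, 'a1, 't2, 't1) utility" where
  "swap_utility J = (\<lambda>a2 a1 \<theta>2 \<theta>1. J a1 a2 \<theta>1 \<theta>2)"

lemma act_exp2_eq_act_exp1: "act_exp2 J b \<sigma>1 = act_exp1 (swap_utility J) b \<sigma>1"
  by (simp add: fun_eq_iff act_exp1_def act_exp2_def swap_utility_def)

lemma exp2_eq_exp1: "exp2 J b \<sigma>1 \<sigma>2 = exp1 (swap_utility J) b \<sigma>2 \<sigma>1"
proof
  fix \<theta>2
  show "exp2 J b \<sigma>1 \<sigma>2 \<theta>2 = exp1 (swap_utility J) b \<sigma>2 \<sigma>1 \<theta>2"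
    unfolding exp1_def exp2_def swap_utility_def
    by (subst sum.swap) (simp add: mult.commute)
qed

lemma value2_eq_value1: "value2 J b \<sigma>1 = value1 (swap_utility J) b \<sigma>1"
  by (simp add: fun_eq_iff value1_def value2_def exp2_eq_exp1)

lemma distribution_mean_le:
  assumes "is_distribution p" and "\<And>a. u a \<le> c"
  shows "(\<Sum>a\<in>UNIV. p a * u a) \<le> c"
proof -
  have "(\<Sum>a\<in>UNIV. p a * u a) \<le> (\<Sum>a\<in>UNIV. p a * c)"
    using assms by (intro sum_mono mult_left_mono) (auto simp: is_distribution_def)
  also have "\<dots> = c"
    using assms(1) by (simp add: is_distribution_def flip: sum_distrib_right)
  finally show ?thesis .
qed

lemma exp1_le:
  assumes "\<sigma>1 \<in> strategies" and "\<And>a. act_exp1 J b \<sigma>2 \<theta> a \<le> c"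
  shows "exp1 J b \<sigma>1 \<sigma>2 \<theta> \<le> c"
  using assms by (auto simp: exp1_eq_sum_act_exp1 strategies_def intro!: distribution_mean_le)

text \<open>Playing one action at every type is a sufficient test deviation, because
  \<open>exp1\<close> at \<theta> reads the own strategy at \<theta> only.\<close>

lemma pure_strategy: "(\<lambda>\<theta> a'. if a' = a then 1 else 0) \<in> strategies"
  by (simp add: strategies_def is_distribution_def)

lemma exp1_pure_strategy:
  "exp1 J b (\<lambda>\<theta> a'. if a' = a then 1 else 0) \<sigma>2 \<theta> = act_exp1 J b \<sigma>2 \<theta> a"
  by (simp add: exp1_eq_sum_act_exp1 if_distrib[of "\<lambda>c. c * _"] cong: if_cong)

text \<open>Pure actions are particular strategies, and every strategy yields a mean of their
  payoffs. The infinitely many deviations thus shrink to finitely many inequalities of the same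
  shape as (a) and (c).\<close>

lemma best_response_iff_no_improving_action:
  "(\<forall>\<tau>1\<in>strategies. exp1 J b \<sigma>1 \<sigma>2 \<theta> \<ge> exp1 J b \<tau>1 \<sigma>2 \<theta>) \<longleftrightarrow>
   (\<forall>a. act_exp1 J b \<sigma>2 \<theta> a \<le> exp1 J b \<sigma>1 \<sigma>2 \<theta>)"
  using exp1_le pure_strategy exp1_pure_strategy by metis

text \<open>The supremum is a maximum, attained at \<open>\<sigma>1\<close> itself.\<close>

lemma value1_eqI:
  assumes "\<sigma>1 \<in> strategies" and "\<And>a. act_exp1 J b \<sigma>2 \<theta> a \<le> exp1 J b \<sigma>1 \<sigma>2 \<theta>"
  shows "value1 J b \<sigma>2 \<theta> = exp1 J b \<sigma>1 \<sigma>2 \<theta>"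
  unfolding value1_def using assms
  by (intro cSup_eq_maximum) (auto intro: exp1_le)

lemma SBNE_iff_no_improving_action:
  "SBNE J1 J2 b1 b2 \<sigma>1 \<sigma>2 \<longleftrightarrow> \<sigma>1 \<in> strategies \<and> \<sigma>2 \<in> strategies \<and>
     (\<forall>\<theta>1 a1. act_exp1 J1 b1 \<sigma>2 \<theta>1 a1 \<le> exp1 J1 b1 \<sigma>1 \<sigma>2 \<theta>1) \<and>
     (\<forall>\<theta>2 a2. act_exp2 J2 b2 \<sigma>1 \<theta>2 a2 \<le> exp2 J2 b2 \<sigma>1 \<sigma>2 \<theta>2)"
  unfolding SBNE_def exp2_eq_exp1 act_exp2_eq_act_exp1 best_response_iff_no_improving_action
  by auto

subsection \<open>Existence of an equilibrium\<close>

text \<open>The Nash map for one player at one type, with \<open>u\<close> the payoffs of the pure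
  actions: each weight grows by the positive part of the action's gain over the current mean, and
  the denominator renormalises.\<close>

definition nash_update :: "('a::finite \<Rightarrow> real) \<Rightarrow> ('a \<Rightarrow> real) \<Rightarrow> 'a \<Rightarrow> real" where
  "nash_update u p a =
     (p a + max 0 (u a - (\<Sum>c\<in>UNIV. p c * u c))) /
     (1 + (\<Sum>d\<in>UNIV. max 0 (u d - (\<Sum>c\<in>UNIV. p c * u c))))"

lemma nash_update_denominator_pos:
  "1 + (\<Sum>d\<in>UNIV. max 0 (v d - (m::real))) > 0"
  by (intro add_pos_nonneg sum_nonneg) auto

lemma is_distribution_nash_update:
  assumes "is_distribution p"
  shows "is_distribution (nash_update u p)"
proof -
  define m where "m = (\<Sum>c\<in>UNIV. p c * u c)"
  have pos: "1 + (\<Sum>d\<in>UNIV. max 0 (u d - m)) > 0"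
    by (rule nash_update_denominator_pos)
  have "(\<Sum>a\<in>UNIV. nash_update u p a) = 1"
    using assms pos
    by (simp add: nash_update_def is_distribution_def sum.distrib flip: sum_divide_distrib m_def)
  moreover have "nash_update u p a \<ge> 0" for a
    using assms pos
    by (auto simp: nash_update_def is_distribution_def simp flip: m_def
        intro!: divide_nonneg_pos add_nonneg_nonneg)
  ultimately show ?thesis
    by (simp add: is_distribution_def)
qed

lemma nash_update_fixpoint:
  assumes "is_distribution p" and fixed: "nash_update u p = p"
  shows "u a \<le> (\<Sum>c\<in>UNIV. p c * u c)"
proof -
  define m where "m = (\<Sum>c\<in>UNIV. p c * u c)"
  define g where "g c = max 0 (u c - m)" for c
  have "1 + (\<Sum>d\<in>UNIV. g d) > 0"
    unfolding g_def by (rule nash_update_denominator_pos)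
  then have g: "g c = p c * (\<Sum>d\<in>UNIV. g d)" for c
    using fun_cong[OF fixed, of c]
    by (simp add: nash_update_def field_simps flip: m_def g_def)
  \<comment> \<open>At a fixed point the gains are proportional to \<open>p\<close>, and the \<open>p\<close>-mean of \<open>u - m\<close> vanishes,
    so the sum of the squared gains is 0.\<close>
  have "(\<Sum>c\<in>UNIV. g c * g c) = (\<Sum>c\<in>UNIV. g c * (u c - m))"
    \<comment> \<open>Each gain is either 0 or equal to \<open>u c - m\<close>, so one factor of the
      square can shed its positive part.\<close>
    by (intro sum.cong) (auto simp: g_def max_def)
  also have "\<dots> = (\<Sum>c\<in>UNIV. (\<Sum>d\<in>UNIV. g d) * (p c * (u c - m)))"
    by (intro sum.cong refl, subst g) (simp add: mult_ac)
  also have "\<dots> = (\<Sum>d\<in>UNIV. g d) * ((\<Sum>c\<in>UNIV. p c * u c) - m * (\<Sum>c\<in>UNIV. p c))"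
    by (simp add: sum_distrib_left sum_subtractf algebra_simps)
  also have "\<dots> = 0"
    using assms(1) by (simp add: is_distribution_def m_def)
  finally have "g a * g a = 0"
    by (subst (asm) sum_nonneg_eq_0_iff) auto
  then show ?thesis
    by (simp add: g_def flip: m_def)
qed

text \<open>Strategies as points of a Euclidean space, the setting of Brouwer's theorem.\<close>

definition strategy_vectors :: "(real ^ 'a::finite ^ 't::finite) set" where
  "strategy_vectors = {v. (\<lambda>\<theta> a. v $ \<theta> $ a) \<in> strategies}"

text \<open>A product of simplices is closed, being cut out by continuous equations and weak
  inequalities, and bounded, since nonnegative entries with sum 1 lie between 0 and 1.\<close>

lemma compact_strategy_vectors:
  "compact (strategy_vectors :: (real ^ 'a::finite ^ 't::finite) set)"
proof -
  have "closed (strategy_vectors :: (real ^ 'a ^ 't) set)"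
    unfolding strategy_vectors_def strategies_def is_distribution_def mem_Collect_eq
    by (intro closed_Collect_all closed_Collect_conj closed_Collect_eq closed_Collect_le
        continuous_intros)
  moreover have "strategy_vectors \<subseteq> {0 .. (\<chi> \<theta> a. 1) :: real ^ 'a ^ 't}"
  proof
    fix v :: "real ^ 'a ^ 't"
    assume "v \<in> strategy_vectors"
    then have v: "v $ \<theta> $ a \<ge> 0" "(\<Sum>a\<in>UNIV. v $ \<theta> $ a) = 1" for \<theta> a
      by (auto simp: strategy_vectors_def strategies_def is_distribution_def)
    have "v $ \<theta> $ a \<le> 1" for \<theta> a
      using member_le_sum[of a UNIV "\<lambda>a. v $ \<theta> $ a"] v by simp
    with v(1) show "v \<in> {0 .. (\<chi> \<theta> a. 1)}"
      by (simp add: less_eq_vec_def)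
  qed
  ultimately show ?thesis
    using bounded_subset[OF bounded_closed_interval] by (auto simp: compact_eq_bounded_closed)
qed

lemma convex_strategy_vectors: "convex strategy_vectors"
  unfolding convex_def strategy_vectors_def strategies_def is_distribution_def
  by (auto simp: sum.distrib simp flip: sum_distrib_left)

lemma strategy_vectors_nonempty: "strategy_vectors \<noteq> {}"
proof -
  \<comment> \<open>Here \<open>undefined\<close> merely names some action, which is then played at
    every type.\<close>
  have "(\<chi> \<theta> a'. if a' = undefined then 1 else 0) \<in> strategy_vectors"
    by (simp add: strategy_vectors_def strategies_def is_distribution_def)
  then show ?thesis by blast
qed

text \<open>Positive parts are continuous, and the denominator never vanishes.\<close>

lemma continuous_on_nash_update:
  assumes "\<And>c. continuous_on S (\<lambda>z. u z c)" and "\<And>c. continuous_on S (\<lambda>z. p z c)"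
  shows "continuous_on S (\<lambda>z. nash_update (u z) (p z) a)"
  unfolding nash_update_def using assms
  by (intro continuous_intros ballI less_imp_neq[symmetric] nash_update_denominator_pos) auto

lemma continuous_on_act_exp1:
  assumes "\<And>\<theta> a. continuous_on S (\<lambda>z. \<sigma> z \<theta> a)"
  shows "continuous_on S (\<lambda>z. act_exp1 J b (\<sigma> z) \<theta> a)"
  unfolding act_exp1_def using assms by (intro continuous_intros)

text \<open>Brouwer's theorem is applied once, to the Nash maps of both players at all types
  jointly. A joint fixed point is a fixed point of each single map, so no type of either player has
  an improving action.\<close>

lemma SBNE_exists: "\<exists>\<sigma>1 \<sigma>2. SBNE J1 J2 b1 b2 \<sigma>1 \<sigma>2"
  for J1 J2 :: "('a1::finite, 'a2::finite, 't1::finite, 't2::finite) utility"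
proof -
  define S where "S = (strategy_vectors :: (real ^ 'a1 ^ 't1) set) \<times>
    (strategy_vectors :: (real ^ 'a2 ^ 't2) set)"
  define \<sigma> where "\<sigma> z \<theta> a = fst z $ \<theta> $ a"
    for z :: "(real ^ 'a1 ^ 't1) \<times> (real ^ 'a2 ^ 't2)" and \<theta> a
  define \<tau> where "\<tau> z \<theta> a = snd z $ \<theta> $ a"
    for z :: "(real ^ 'a1 ^ 't1) \<times> (real ^ 'a2 ^ 't2)" and \<theta> a
  define u where "u z = act_exp1 J1 b1 (\<tau> z)" for z
  define v where "v z = act_exp1 (swap_utility J2) b2 (\<sigma> z)" for z
  \<comment> \<open>Both players update simultaneously, each type against the payoffs induced by the
    opponent's current strategy.\<close>
  define f where "f z =
    ((\<chi> \<theta> a. nash_update (u z \<theta>) (\<sigma> z \<theta>) a),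
     (\<chi> \<theta> a. nash_update (v z \<theta>) (\<tau> z \<theta>) a))" for z
  have mem_S: "z \<in> S \<longleftrightarrow> \<sigma> z \<in> strategies \<and> \<tau> z \<in> strategies" for z
    by (cases z) (simp add: S_def strategy_vectors_def \<sigma>_def[abs_def] \<tau>_def[abs_def])
  have proj: "continuous_on S (\<lambda>z. \<sigma> z \<theta>1 a1)" "continuous_on S (\<lambda>z. \<tau> z \<theta>2 a2)" for \<theta>1 a1 \<theta>2 a2
    unfolding \<sigma>_def \<tau>_def by (intro continuous_intros)+
  have "compact S" "convex S" "S \<noteq> {}"
    by (auto simp: S_def compact_Times compact_strategy_vectors convex_Times
        convex_strategy_vectors strategy_vectors_nonempty)
  moreover have "continuous_on S f"
    unfolding f_def u_def v_def
    by (intro continuous_on_Pair continuous_on_vec_lambda continuous_on_nash_update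
        continuous_on_act_exp1 proj)
  moreover have "f \<in> S \<rightarrow> S"
  proof
    fix z assume "z \<in> S"
    moreover have "\<sigma> (f z) = (\<lambda>\<theta>. nash_update (u z \<theta>) (\<sigma> z \<theta>))"
      "\<tau> (f z) = (\<lambda>\<theta>. nash_update (v z \<theta>) (\<tau> z \<theta>))"
      by (auto simp: f_def fun_eq_iff \<sigma>_def[of "(_, _)"] \<tau>_def[of "(_, _)"])
    ultimately show "f z \<in> S"
      by (simp add: mem_S strategies_def is_distribution_nash_update)
  qed
  ultimately obtain z where z: "z \<in> S" "f z = z"
    by (rule brouwer)
  have "nash_update (u z \<theta>1) (\<sigma> z \<theta>1) = \<sigma> z \<theta>1" "nash_update (v z \<theta>2) (\<tau> z \<theta>2) = \<tau> z \<theta>2" for \<theta>1 \<theta>2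
    using z(2) by (auto simp: f_def \<sigma>_def \<tau>_def prod_eq_iff vec_eq_iff)
  then have "SBNE J1 J2 b1 b2 (\<sigma> z) (\<tau> z)"
    using z(1) unfolding SBNE_iff_no_improving_action exp2_eq_exp1 act_exp2_eq_act_exp1
    by (auto simp: mem_S exp1_eq_sum_act_exp1 strategies_def simp flip: u_def v_def
        intro!: nash_update_fixpoint)
  then show ?thesis by blast
qed

subsection \<open>The optimization problem\<close>

lemma feasible_iff:
  "feasible J1 J2 b1 b2 (\<sigma>1, \<sigma>2, s1, s2) \<longleftrightarrow>
     \<sigma>1 \<in> strategies \<and> \<sigma>2 \<in> strategies \<and>
     (\<forall>\<theta>1 a1. act_exp1 J1 b1 \<sigma>2 \<theta>1 a1 \<le> - s1 \<theta>1) \<and>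
     (\<forall>\<theta>2 a2. act_exp2 J2 b2 \<sigma>1 \<theta>2 a2 \<le> - s2 \<theta>2)"
  by (auto simp: strategies_def is_distribution_def)

lemma objective_eq:
  "objective J1 J2 b1 b2 \<alpha>1 \<alpha>2 (\<sigma>1, \<sigma>2, s1, s2) =
     (\<Sum>\<theta>1\<in>UNIV. \<alpha>1 \<theta>1 * (s1 \<theta>1 + exp1 J1 b1 \<sigma>1 \<sigma>2 \<theta>1)) +
     (\<Sum>\<theta>2\<in>UNIV. \<alpha>2 \<theta>2 * (s2 \<theta>2 + exp2 J2 b2 \<sigma>1 \<sigma>2 \<theta>2))"
  by (simp add: sum.distrib distrib_left)

text \<open>Constraint (c) is averaged with \<open>\<sigma>1\<close>, and constraint (a), after
  exchanging the players, with \<open>\<sigma>2\<close>.\<close>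

lemma feasible_imp_exp_le:
  assumes "feasible J1 J2 b1 b2 (\<sigma>1, \<sigma>2, s1, s2)"
  shows "s1 \<theta>1 + exp1 J1 b1 \<sigma>1 \<sigma>2 \<theta>1 \<le> 0" and "s2 \<theta>2 + exp2 J2 b2 \<sigma>1 \<sigma>2 \<theta>2 \<le> 0"
  using assms exp1_le[of \<sigma>1 J1 b1 \<sigma>2 \<theta>1 "- s1 \<theta>1"]
    exp1_le[of \<sigma>2 "swap_utility J2" b2 \<sigma>1 \<theta>2 "- s2 \<theta>2"]
  unfolding feasible_iff exp2_eq_exp1 act_exp2_eq_act_exp1 by auto

text \<open>Nonpositive terms cannot cancel, and strictly positive weights let a vanishing sum be
  traced back to every single \<open>f \<theta>\<close>.\<close>

lemma weighted_sum_nonpos_eq_0_iff: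
  fixes \<alpha> f :: "'t::finite \<Rightarrow> real"
  assumes "\<And>\<theta>. \<alpha> \<theta> > 0" and "\<And>\<theta>. f \<theta> \<le> 0"
  shows "(\<Sum>\<theta>\<in>UNIV. \<alpha> \<theta> * f \<theta>) \<le> 0" and "(\<Sum>\<theta>\<in>UNIV. \<alpha> \<theta> * f \<theta>) = 0 \<longleftrightarrow> (\<forall>\<theta>. f \<theta> = 0)"
proof -
  have nonpos: "\<alpha> \<theta> * f \<theta> \<le> 0" for \<theta>
    using assms by (simp add: mult_nonneg_nonpos less_imp_le)
  then show "(\<Sum>\<theta>\<in>UNIV. \<alpha> \<theta> * f \<theta>) \<le> 0"
    by (intro sum_nonpos)
  have "(\<Sum>\<theta>\<in>UNIV. \<alpha> \<theta> * f \<theta>) = 0 \<longleftrightarrow> (\<forall>\<theta>. \<alpha> \<theta> * f \<theta> = 0)"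
    using nonpos sum_nonneg_eq_0_iff[of UNIV "\<lambda>\<theta>. - (\<alpha> \<theta> * f \<theta>)"] by (simp add: sum_negf)
  also have "\<dots> \<longleftrightarrow> (\<forall>\<theta>. f \<theta> = 0)"
    using assms(1) by (auto simp: less_imp_neq[symmetric])
  finally show "(\<Sum>\<theta>\<in>UNIV. \<alpha> \<theta> * f \<theta>) = 0 \<longleftrightarrow> (\<forall>\<theta>. f \<theta> = 0)" .
qed

lemma objective_nonpos_eq_0_iff:
  assumes "feasible J1 J2 b1 b2 (\<sigma>1, \<sigma>2, s1, s2)"
    and "\<And>\<theta>1. \<alpha>1 \<theta>1 > 0" and "\<And>\<theta>2. \<alpha>2 \<theta>2 > 0"
  shows "objective J1 J2 b1 b2 \<alpha>1 \<alpha>2 (\<sigma>1, \<sigma>2, s1, s2) \<le> 0"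
    and "objective J1 J2 b1 b2 \<alpha>1 \<alpha>2 (\<sigma>1, \<sigma>2, s1, s2) = 0 \<longleftrightarrow>
      (\<forall>\<theta>1. s1 \<theta>1 = - exp1 J1 b1 \<sigma>1 \<sigma>2 \<theta>1) \<and> (\<forall>\<theta>2. s2 \<theta>2 = - exp2 J2 b2 \<sigma>1 \<sigma>2 \<theta>2)"
proof -
  note w1 = weighted_sum_nonpos_eq_0_iff[where \<alpha> = \<alpha>1, OF assms(2) feasible_imp_exp_le(1)[OF assms(1)]]
  note w2 = weighted_sum_nonpos_eq_0_iff[where \<alpha> = \<alpha>2, OF assms(3) feasible_imp_exp_le(2)[OF assms(1)]]
  show "objective J1 J2 b1 b2 \<alpha>1 \<alpha>2 (\<sigma>1, \<sigma>2, s1, s2) \<le> 0"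
    unfolding objective_eq using w1(1) w2(1) by (rule add_nonpos_nonpos)
  show "objective J1 J2 b1 b2 \<alpha>1 \<alpha>2 (\<sigma>1, \<sigma>2, s1, s2) = 0 \<longleftrightarrow>
      (\<forall>\<theta>1. s1 \<theta>1 = - exp1 J1 b1 \<sigma>1 \<sigma>2 \<theta>1) \<and> (\<forall>\<theta>2. s2 \<theta>2 = - exp2 J2 b2 \<sigma>1 \<sigma>2 \<theta>2)"
    unfolding objective_eq add_nonpos_eq_0_iff[OF w1(1) w2(1)] w1(2) w2(2)
    by (simp add: eq_neg_iff_add_eq_0)
qed

text \<open>The maximum of the objective is exactly 0, so optimality means feasibility with
  objective 0. This determines \<open>s1\<close> and \<open>s2\<close> and leaves the equilibrium
  condition on the strategies.\<close>

lemma optimal_solution_iff_SBNE: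
  fixes J1 J2 :: "('a1::finite, 'a2::finite, 't1::finite, 't2::finite) utility"
  assumes "\<And>\<theta>1. \<alpha>1 \<theta>1 > 0" and "\<And>\<theta>2. \<alpha>2 \<theta>2 > 0"
  shows "optimal_solution J1 J2 b1 b2 \<alpha>1 \<alpha>2 (\<sigma>1, \<sigma>2, s1, s2) \<longleftrightarrow>
     SBNE J1 J2 b1 b2 \<sigma>1 \<sigma>2 \<and>
     s1 = (\<lambda>\<theta>1. - exp1 J1 b1 \<sigma>1 \<sigma>2 \<theta>1) \<and> s2 = (\<lambda>\<theta>2. - exp2 J2 b2 \<sigma>1 \<sigma>2 \<theta>2)"
proof -
  let ?F = "feasible J1 J2 b1 b2" and ?O = "objective J1 J2 b1 b2 \<alpha>1 \<alpha>2"
  note obj = objective_nonpos_eq_0_iff[of J1 J2 b1 b2, OF _ assms]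
  have zero_iff: "?F (\<sigma>1, \<sigma>2, s1, s2) \<and> ?O (\<sigma>1, \<sigma>2, s1, s2) = 0 \<longleftrightarrow>
     SBNE J1 J2 b1 b2 \<sigma>1 \<sigma>2 \<and>
     s1 = (\<lambda>\<theta>1. - exp1 J1 b1 \<sigma>1 \<sigma>2 \<theta>1) \<and> s2 = (\<lambda>\<theta>2. - exp2 J2 b2 \<sigma>1 \<sigma>2 \<theta>2)"
    for \<sigma>1 \<sigma>2 s1 s2
  proof -
    have "?F (\<sigma>1, \<sigma>2, s1, s2) \<and> ?O (\<sigma>1, \<sigma>2, s1, s2) = 0 \<longleftrightarrow> ?F (\<sigma>1, \<sigma>2, s1, s2) \<and>
        s1 = (\<lambda>\<theta>1. - exp1 J1 b1 \<sigma>1 \<sigma>2 \<theta>1) \<and> s2 = (\<lambda>\<theta>2. - exp2 J2 b2 \<sigma>1 \<sigma>2 \<theta>2)"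
      using obj(2)[of \<sigma>1 \<sigma>2 s1 s2]
      by (cases "?F (\<sigma>1, \<sigma>2, s1, s2)") (simp_all only: fun_eq_iff simp_thms)
    \<comment> \<open>Once \<open>s1\<close> and \<open>s2\<close> are replaced by the negated
      expected utilities, (a) and (c) become the conditions that no action improves.\<close>
    then show ?thesis
      unfolding feasible_iff SBNE_iff_no_improving_action by auto
  qed
  \<comment> \<open>An equilibrium supplies a feasible point of value 0, which forces every optimal
    solution to have value 0 as well.\<close>
  obtain \<tau>1 \<tau>2 where "SBNE J1 J2 b1 b2 \<tau>1 \<tau>2"
    using SBNE_exists by blast
  then obtain y where y: "?F y" "?O y = 0"
    using zero_iff[of \<tau>1 \<tau>2 "\<lambda>\<theta>1. - exp1 J1 b1 \<tau>1 \<tau>2 \<theta>1" "\<lambda>\<theta>2. - exp2 J2 b2 \<tau>1 \<tau>2 \<theta>2"]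
    by metis
  have nonpos: "?O z \<le> 0" if "?F z" for z
    using obj(1)[of "fst z" "fst (snd z)" "fst (snd (snd z))" "snd (snd (snd z))"] that
    by (simp only: prod.collapse)
  have "optimal_solution J1 J2 b1 b2 \<alpha>1 \<alpha>2 (\<sigma>1, \<sigma>2, s1, s2) \<longleftrightarrow>
      ?F (\<sigma>1, \<sigma>2, s1, s2) \<and> ?O (\<sigma>1, \<sigma>2, s1, s2) = 0"
    unfolding optimal_solution_def is_arg_max_def using y nonpos by (metis leD order_less_le)
  with zero_iff[of \<sigma>1 \<sigma>2 s1 s2] show ?thesis by (simp only:)
qed

text \<open>Equilibrium strategies are best responses and hence attain the suprema.\<close>

lemma SBNE_imp_value:
  assumes "SBNE J1 J2 b1 b2 \<sigma>1 \<sigma>2"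
  shows "value1 J1 b1 \<sigma>2 \<theta>1 = exp1 J1 b1 \<sigma>1 \<sigma>2 \<theta>1"
    and "value2 J2 b2 \<sigma>1 \<theta>2 = exp2 J2 b2 \<sigma>1 \<sigma>2 \<theta>2"
  using assms
  unfolding SBNE_iff_no_improving_action exp2_eq_exp1 act_exp2_eq_act_exp1 value2_eq_value1
  by (auto intro: value1_eqI)

theorem theorem1:
  fixes x :: 'x
    and J1 J2 :: "'x \<Rightarrow> ('a1::finite, 'a2::finite, 't1::finite, 't2::finite) utility"
    and b1 :: "'x \<Rightarrow> 't1 \<Rightarrow> 't2 \<Rightarrow> real"
    and b2 :: "'x \<Rightarrow> 't2 \<Rightarrow> 't1 \<Rightarrow> real"
    and \<alpha>1 :: "'t1 \<Rightarrow> real"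
    and \<alpha>2 :: "'t2 \<Rightarrow> real"
  assumes "b1 x \<in> beliefs" and "b2 x \<in> beliefs"
    and "\<And>\<theta>1. \<alpha>1 \<theta>1 > 0" and "\<And>\<theta>2. \<alpha>2 \<theta>2 > 0"
  shows "(\<forall>\<sigma>1\<in>strategies. \<forall>\<sigma>2\<in>strategies.
            SBNE (J1 x) (J2 x) (b1 x) (b2 x) \<sigma>1 \<sigma>2 \<longleftrightarrow>
            (\<exists>s1 s2. optimal_solution (J1 x) (J2 x) (b1 x) (b2 x) \<alpha>1 \<alpha>2 (\<sigma>1, \<sigma>2, s1, s2)))
       \<and> (\<exists>\<sigma>1 \<sigma>2 s1 s2. optimal_solution (J1 x) (J2 x) (b1 x) (b2 x) \<alpha>1 \<alpha>2 (\<sigma>1, \<sigma>2, s1, s2))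
       \<and> (\<forall>\<sigma>1 \<sigma>2 s1 s2. optimal_solution (J1 x) (J2 x) (b1 x) (b2 x) \<alpha>1 \<alpha>2 (\<sigma>1, \<sigma>2, s1, s2) \<longrightarrow>
            (\<forall>\<theta>2. s2 \<theta>2 = - value2 (J2 x) (b2 x) \<sigma>1 \<theta>2) \<and>
            (\<forall>\<theta>1. s1 \<theta>1 = - value1 (J1 x) (b1 x) \<sigma>2 \<theta>1))"
  \<comment> \<open>An equilibrium, completed by its negated expected utilities, witnesses the
    existence of an optimal solution.\<close>
  using SBNE_exists[of "J1 x" "J2 x" "b1 x" "b2 x"]
  by (auto simp: optimal_solution_iff_SBNE[OF assms(3,4)] SBNE_imp_value)

end
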